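(* Let $n,m\ge1$ be integers, $X_1,\dots,X_n\in\mathbb{R}$, $a_1,\dots,a_m\in\mathbb{R}$, and let $Z$, $F_Z$, $z_{\min}$, $z_{\max}$, $T_Z$ be as defined in the context. Assume $z_{\min}<0<z_{\max}$. Let $T>T_Z$ be fixed, $\kappa:=T/T_Z$ and $I:=[\kappa z_{\min},\kappa z_{\max}]$. For each integer $N\ge1$ let $\tilde f$ (depending on $N$ and $T$) be as defined in the context and set $$\tilde F(x):=\int_{-\infty}^x\frac NT\,\tilde f(\xi)\,1_I(\xi)\,d\xi,\qquad x\in\mathbb{R}.$$ Then for each $x\in\mathbb{R}$ that is not a point of discontinuity of $F_Z$, $$\left|\tilde F(x)-F_Z(x)\right|=O(N^{-1/2})\qquad\text{as }N\to\infty .$$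
   Context: $\mathrm{i}$ denotes the imaginary unit. Let $\hat F_n(x)=n^{-1}\sum_{l=1}^n 1_{X_l\le x}$ be the empirical distribution function of the fixed real numbers $X_1,\dots,X_n$. Let $X^{[1]},\dots,X^{[m]}$ be independent random variables, each with distribution function $\hat F_n$, and set $Z:=\sum_{j=1}^m a_jX^{[j]}$. $F_Z$ is the cumulative distribution function of $Z$, $F_Z(x)=P(Z\le x)$. The random variable $Z$ takes finitely many values; $z_{\min}$ and $z_{\max}$ denote the smallest and largest value taken with positive probability, and $T_Z:=z_{\max}-z_{\min}$. Define $G(\nu):=\prod_{j=1}^m\left(\frac1n\sum_{l=1}^n\exp(-2\pi\mathrm{i}\,a_jX_l\nu)\right)$ for $\nu\in\mathbb{R}$, $\Delta\nu:=1/T$, $g_k:=G(k\,\Delta\nu)$ for $k\in\mathbb{Z}$, and $$\tilde f(x):=\frac1N\sum_{k=-N+1}^{N-1}g_k\exp(2\pi\mathrm{i}\,xk/T),\qquad x\in\mathbb{R}$$ (this function is real-valued). *)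

theory Defs
  imports "HOL-Probability.Probability"
begin

definition emp_cdf :: "nat \<Rightarrow> (nat \<Rightarrow> real) \<Rightarrow> real \<Rightarrow> real" where
  "emp_cdf n X x = (\<Sum>l=1..n. of_bool (X l \<le> x)) / real n"

definition pos_prob_values :: "'w measure \<Rightarrow> ('w \<Rightarrow> real) \<Rightarrow> real set" where
  "pos_prob_values M Z = {z. measure M {\<omega> \<in> space M. Z \<omega> = z} > 0}"

text \<open>\<open>Min\<close> and \<open>Max\<close> are meaningful only on finite nonempty sets; here \<open>Z\<close> is a finite linear
  combination of variables with empirical distribution functions, so
  \<open>pos_prob_values M Z\<close> is finite and nonempty.\<close>

definition z_min :: "'w measure \<Rightarrow> ('w \<Rightarrow> real) \<Rightarrow> real" where
  "z_min M Z = Min (pos_prob_values M Z)"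

definition z_max :: "'w measure \<Rightarrow> ('w \<Rightarrow> real) \<Rightarrow> real" where
  "z_max M Z = Max (pos_prob_values M Z)"

definition T_range :: "'w measure \<Rightarrow> ('w \<Rightarrow> real) \<Rightarrow> real" where
  "T_range M Z = z_max M Z - z_min M Z"

definition G_fun :: "nat \<Rightarrow> nat \<Rightarrow> (nat \<Rightarrow> real) \<Rightarrow> (nat \<Rightarrow> real) \<Rightarrow> real \<Rightarrow> complex" where
  "G_fun n m X a \<nu> =
     (\<Prod>j=1..m. (1 / of_nat n) * (\<Sum>l=1..n. exp (- 2 * of_real pi * \<i> * of_real (a j * X l * \<nu>))))"

definition g_coeff :: "nat \<Rightarrow> nat \<Rightarrow> (nat \<Rightarrow> real) \<Rightarrow> (nat \<Rightarrow> real) \<Rightarrow> real \<Rightarrow> int \<Rightarrow> complex" where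
  "g_coeff n m X a T k = G_fun n m X a (of_int k * (1 / T))"

definition f_tilde_complex ::
  "nat \<Rightarrow> nat \<Rightarrow> (nat \<Rightarrow> real) \<Rightarrow> (nat \<Rightarrow> real) \<Rightarrow> real \<Rightarrow> nat \<Rightarrow> real \<Rightarrow> complex" where
  "f_tilde_complex n m X a T N x =
     (1 / of_nat N) * (\<Sum>k = - int N + 1..int N - 1.
        g_coeff n m X a T k * exp (2 * of_real pi * \<i> * of_real (x * of_int k / T)))"

text \<open>The sum above is real, see \<open>of_real_f_tilde\<close> below, so taking the real part only changes
  the type.\<close>

definition f_tilde ::
  "nat \<Rightarrow> nat \<Rightarrow> (nat \<Rightarrow> real) \<Rightarrow> (nat \<Rightarrow> real) \<Rightarrow> real \<Rightarrow> nat \<Rightarrow> real \<Rightarrow> real" where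
  "f_tilde n m X a T N x = Re (f_tilde_complex n m X a T N x)"

lemma cnj_g_coeff: "cnj (g_coeff n m X a T k) = g_coeff n m X a T (- k)"
  by (simp add: g_coeff_def G_fun_def exp_cnj)

lemma of_real_f_tilde: "complex_of_real (f_tilde n m X a T N x) = f_tilde_complex n m X a T N x"
proof -
  have "cnj (f_tilde_complex n m X a T N x) =
      (1 / of_nat N) * (\<Sum>k = - int N + 1..int N - 1.
        g_coeff n m X a T (- k) * exp (2 * of_real pi * \<i> * of_real (x * of_int (- k) / T)))"
    by (simp add: f_tilde_complex_def cnj_g_coeff exp_cnj)
  also have "\<dots> = f_tilde_complex n m X a T N x"
    unfolding f_tilde_complex_def
    by (rule arg_cong[where f = "\<lambda>s. (1 / of_nat N) * s"],
        rule sum.reindex_bij_witness[where i = uminus and j = uminus]) auto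
  finally show ?thesis
    unfolding f_tilde_def using Reals_cnj_iff of_real_Re by blast
qed

definition F_tilde ::
  "nat \<Rightarrow> nat \<Rightarrow> (nat \<Rightarrow> real) \<Rightarrow> (nat \<Rightarrow> real) \<Rightarrow> real \<Rightarrow> real set \<Rightarrow> nat \<Rightarrow> real \<Rightarrow> real" where
  "F_tilde n m X a T I N x =
     (LBINT \<xi>:{..x}. real N / T * f_tilde n m X a T N \<xi> * indicator I \<xi>)"

end

theory Submission
  imports Defs
begin

text \<open>The law of \<open>Z\<close> has finitely many atoms \<open>z\<close>, with masses \<open>p\<^sub>z\<close>, and \<open>G \<nu>\<close> is its characteristic
  function at \<open>-2 \<pi> \<nu>\<close>. Hence \<open>(N / T) f~ = (\<Sum>z. p\<^sub>z D\<^sub>N(\<xi> - z))\<close> with the \<open>T\<close>-periodic Dirichlet kernel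
  \<open>D\<^sub>N\<close>, whose odd primitive converges to \<open>sgn u / 2\<close> at rate \<open>O(1 / N)\<close> for every fixed \<open>u \<noteq> 0\<close> with
  \<open>\<bar>u\<bar> < T\<close>. Since \<open>I\<close> has length \<open>T\<close> and all atoms lie in its interior, the differences
  between the endpoints of integration and the atoms stay in that range, so for a fixed continuity
  point the error is even \<open>O(1 / N)\<close>.\<close>

section \<open>The Dirichlet kernel and its primitive\<close>

text \<open>For \<open>N >= 1\<close> this is the termwise integral from 0 to \<open>u\<close> of
  (1/T) times the sum of exp(2 pi i k t / T) over |k| < N. Frequency 0 gives the linear term, each
  pair k, -k one sine.\<close>

definition dirichlet_primitive :: "real \<Rightarrow> nat \<Rightarrow> real \<Rightarrow> real" where
  "dirichlet_primitive T N u = u / T + (\<Sum>k=1..<N. sin (real k * (2 * pi * u / T)) / real k) / pi"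

text \<open>Each cosine times sin(t/2) is half a difference of two sines, so the sum telescopes. The
  multiplied form stays valid where sin(t/2) vanishes.\<close>

lemma dirichlet_kernel_closed_form:
  fixes t :: real
  assumes "N \<ge> 1"
  shows "sin (t / 2) * (1 + 2 * (\<Sum>k=1..<N. cos (real k * t))) = sin ((real N - 1 / 2) * t)"
  using assms
proof (induction N rule: nat_induct_at_least)
  case base
  show ?case by simp
next
  case (Suc N)
  have "2 * sin (t / 2) * cos (real N * t) = sin ((real N + 1 / 2) * t) - sin ((real N - 1 / 2) * t)"
    by (simp add: ring_distribs left_diff_distrib sin_add sin_diff)
  then show ?case
    using Suc by (simp add: algebra_simps)
qed

text \<open>Moving from \<open>\<theta>\<close> towards pi brings t/2 closer to the maximum of sine
  at pi/2. This keeps the denominators below away from zero, on either side of pi.\<close>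

lemma sin_half_ge_on_segment_pi:
  fixes \<theta> t :: real
  assumes "0 < \<theta>" "\<theta> < 2 * pi" "t \<in> closed_segment \<theta> pi"
  shows "sin (\<theta> / 2) \<le> sin (t / 2)"
proof (cases "\<theta> \<le> pi")
  case True
  with assms show ?thesis
    by (intro sin_monotone_2pi_le) (auto simp: closed_segment_eq_real_ivl)
next
  case False
  have "sin (pi - \<theta> / 2) \<le> sin (pi - t / 2)"
    using assms False by (intro sin_monotone_2pi_le) (auto simp: closed_segment_eq_real_ivl)
  then show ?thesis by simp
qed

text \<open>In the constant, the first summand is a mean value bound over a path of length at most
  pi, the second a boundary term. Both blow up as \<open>\<theta>\<close> approaches 0 or 2 pi, so
  the estimate is pointwise, not uniform.\<close>

lemma sawtooth_partial_sum_bound: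
  fixes \<theta> :: real
  assumes \<theta>: "0 < \<theta>" "\<theta> < 2 * pi" and N: "N \<ge> 1"
  shows "\<bar>(\<Sum>k=1..<N. sin (real k * \<theta>) / real k) - (pi - \<theta>) / 2\<bar>
    \<le> (pi / (2 * (sin (\<theta> / 2))\<^sup>2) + 1 / sin (\<theta> / 2)) / real N"
proof -
  define s where "s = sin (\<theta> / 2)"
  define c where "c = real N - 1 / 2"
  define R where "R t = (\<Sum>k=1..<N. sin (real k * t) / real k) - (pi - t) / 2" for t
  \<comment> \<open>The correction \<open>E\<close> comes from integrating \<open>R' t = sin (c t) / (2 sin (t / 2))\<close> by parts;
    it makes the derivative of \<open>R + E\<close> of order \<open>1 / N\<close>, and both \<open>R\<close> and \<open>E\<close> vanish at \<open>\<pi>\<close>.\<close>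
  define E where "E t = cos (c * t) / (2 * c * sin (t / 2))" for t
  have s: "s > 0" unfolding s_def using \<theta> by (intro sin_gt_zero) auto
  have c: "c > 0" "2 * c \<ge> real N" using N by (auto simp: c_def)
  \<comment> \<open>Differentiating \<open>E\<close> yields - sin(c t) / (2 sin(t/2)), which cancels
    the derivative of \<open>R\<close>; \<open>D\<close> is the remaining term, which carries a
    factor 1/c.\<close>
  define D where "D t = - (cos (c * t) * cos (t / 2)) / (4 * c * (sin (t / 2))\<^sup>2)" for t
  have der: "((\<lambda>t. R t + E t) has_field_derivative D t) (at t within closed_segment \<theta> pi)"
    if t: "t \<in> closed_segment \<theta> pi" for t
  proof -
    have st: "sin (t / 2) > 0"
      using sin_half_ge_on_segment_pi[OF \<theta> t] s unfolding s_def by linarith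
    have "(R has_field_derivative (\<Sum>k=1..<N. cos (real k * t)) + 1 / 2) (at t)"
      unfolding R_def
      by (auto intro!: derivative_eq_intros sum.cong)
    moreover have "(E has_field_derivative
        (- (c * sin (c * t)) * (2 * c * sin (t / 2)) - cos (c * t) * (c * cos (t / 2)))
          / (2 * c * sin (t / 2))\<^sup>2) (at t)"
      unfolding E_def using st c
      by (auto intro!: derivative_eq_intros simp: power2_eq_square algebra_simps)
    ultimately have "((\<lambda>t. R t + E t) has_field_derivative
        (\<Sum>k=1..<N. cos (real k * t)) + 1 / 2 +
        (- (c * sin (c * t)) * (2 * c * sin (t / 2)) - cos (c * t) * (c * cos (t / 2)))
          / (2 * c * sin (t / 2))\<^sup>2) (at t)"
      by (rule DERIV_add)
    moreover have "(\<Sum>k=1..<N. cos (real k * t)) + 1 / 2 = sin (c * t) / (2 * sin (t / 2))"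
      using dirichlet_kernel_closed_form[OF N, of t] st
      by (simp add: c_def field_simps)
    moreover have "sin (c * t) / (2 * sin (t / 2)) +
        (- (c * sin (c * t)) * (2 * c * sin (t / 2)) - cos (c * t) * (c * cos (t / 2)))
          / (2 * c * sin (t / 2))\<^sup>2 = D t"
      unfolding D_def using st c by (simp add: field_simps power2_eq_square)
    ultimately show ?thesis
      by (simp add: has_field_derivative_at_within)
  qed
  have bound: "norm (D t) \<le> 1 / (2 * real N * s\<^sup>2)" if t: "t \<in> closed_segment \<theta> pi" for t
  proof -
    have "s\<^sup>2 \<le> (sin (t / 2))\<^sup>2"
      using sin_half_ge_on_segment_pi[OF \<theta> t] s by (simp add: s_def power_mono)
    then have "2 * real N * s\<^sup>2 \<le> 4 * c * (sin (t / 2))\<^sup>2"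
      using mult_mono[of "2 * real N" "4 * c" "s\<^sup>2" "(sin (t / 2))\<^sup>2"] c by simp
    moreover have "\<bar>cos (c * t) * cos (t / 2)\<bar> \<le> 1"
      unfolding abs_mult using mult_mono[OF abs_cos_le_one abs_cos_le_one] by force
    moreover have "0 < 2 * real N * s\<^sup>2" using N s by simp
    ultimately show ?thesis
      unfolding D_def using c by (simp add: abs_mult frac_le)
  qed
  have "norm ((R \<theta> + E \<theta>) - (R pi + E pi)) \<le> 1 / (2 * real N * s\<^sup>2) * norm (\<theta> - pi)"
    using der bound by (rule field_differentiable_bound[OF convex_closed_segment]) auto
  moreover have "R pi = 0" by (simp add: R_def)
  moreover have "E pi = 0"
  proof -
    \<comment> \<open>\<open>c * pi\<close> is an odd multiple of pi/2.\<close>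
    have "cos (c * pi) = 0"
      using N by (simp add: c_def left_diff_distrib cos_diff)
    then show ?thesis by (simp add: E_def)
  qed
  moreover have "1 / (2 * real N * s\<^sup>2) * norm (\<theta> - pi) \<le> 1 / (2 * real N * s\<^sup>2) * pi"
    using \<theta> by (intro mult_left_mono) auto
  moreover have "\<bar>E \<theta>\<bar> \<le> 1 / (real N * s)"
    unfolding E_def s_def[symmetric] using c s N
    by (auto simp: abs_mult intro!: frac_le)
  ultimately have "\<bar>R \<theta>\<bar> \<le> 1 / (2 * real N * s\<^sup>2) * pi + 1 / (real N * s)"
    by (simp add: abs_le_iff)
  also have "\<dots> = (pi / (2 * s\<^sup>2) + 1 / s) / real N"
    using s N by (simp add: field_simps)
  finally show ?thesis by (simp add: R_def s_def)
qed

lemma dirichlet_primitive_minus: "dirichlet_primitive T N (- u) = - dirichlet_primitive T N u"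
  by (simp add: dirichlet_primitive_def sum_negf)

text \<open>The linear term u/T cancels the slope of the sawtooth limit, leaving the constant 1/2
  for positive \<open>u\<close>; oddness settles negative \<open>u\<close>. The implied constant
  depends on \<open>u\<close>.\<close>

lemma dirichlet_primitive_bigo:
  assumes "T > 0" "u \<noteq> 0" "\<bar>u\<bar> < T"
  shows "(\<lambda>N. dirichlet_primitive T N u - sgn u / 2) \<in> O(\<lambda>N. 1 / real N)"
proof -
  have pos: "(\<lambda>N. dirichlet_primitive T N v - 1 / 2) \<in> O(\<lambda>N. 1 / real N)" if v: "0 < v" "v < T" for v
  proof -
    define \<theta> where "\<theta> = 2 * pi * v / T"
    define C where "C = pi / (2 * (sin (\<theta> / 2))\<^sup>2) + 1 / sin (\<theta> / 2)"
    have \<theta>: "0 < \<theta>" "\<theta> < 2 * pi" using v assms by (auto simp: \<theta>_def field_simps)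
    have "norm (dirichlet_primitive T N v - 1 / 2) \<le> (C / pi) * norm (1 / real N)" if "N \<ge> 1" for N
    proof -
      have "dirichlet_primitive T N v - 1 / 2 =
          ((\<Sum>k=1..<N. sin (real k * \<theta>) / real k) - (pi - \<theta>) / 2) / pi"
        using assms by (simp add: dirichlet_primitive_def \<theta>_def field_simps)
      then have "norm (dirichlet_primitive T N v - 1 / 2) =
          \<bar>(\<Sum>k=1..<N. sin (real k * \<theta>) / real k) - (pi - \<theta>) / 2\<bar> / pi"
        by simp
      also have "\<dots> \<le> (C / real N) / pi"
        unfolding C_def using sawtooth_partial_sum_bound[OF \<theta> that] by (intro divide_right_mono) auto
      finally show ?thesis by (simp add: field_simps)
    qed
    then show ?thesis
      by (intro bigoI[where c = "C / pi"] eventually_sequentiallyI[of 1]) auto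
  qed
  show ?thesis
  proof (cases "u > 0")
    case True
    with assms pos[of u] show ?thesis by simp
  next
    case False
    then have "(\<lambda>N. - (dirichlet_primitive T N (- u) - 1 / 2)) \<in> O(\<lambda>N. 1 / real N)"
      using assms pos[of "- u"] by (subst landau_o.big.uminus_in_iff) auto
    moreover have "sgn u = - 1" using assms False by simp
    ultimately show ?thesis by (simp add: dirichlet_primitive_minus add.commute)
  qed
qed

lemma has_field_derivative_dirichlet_primitive:
  assumes "T \<noteq> 0"
  shows "(dirichlet_primitive T N has_field_derivative
    (1 + 2 * (\<Sum>k=1..<N. cos (real k * (2 * pi * u / T)))) / T) (at u)"
proof -
  let ?c = "\<lambda>k. cos (real k * (2 * pi * u / T))"
  have "((\<lambda>u. sin (real k * (2 * pi * u / T)) / real k) has_field_derivative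
      2 * pi / T * ?c k) (at u)" if "k \<in> {1..<N}" for k
    using that assms by (auto intro!: derivative_eq_intros simp: field_simps)
  then have "((\<lambda>u. \<Sum>k=1..<N. sin (real k * (2 * pi * u / T)) / real k) has_field_derivative
      (\<Sum>k=1..<N. 2 * pi / T * ?c k)) (at u)"
    by (rule DERIV_sum)
  then have "((\<lambda>u. u / T + (\<Sum>k=1..<N. sin (real k * (2 * pi * u / T)) / real k) / pi)
      has_field_derivative 1 / T + (\<Sum>k=1..<N. 2 * pi / T * ?c k) / pi) (at u)"
    by (intro DERIV_add DERIV_cdivide DERIV_ident)
  moreover have "1 / T + (\<Sum>k=1..<N. 2 * pi / T * ?c k) / pi = (1 + 2 * (\<Sum>k=1..<N. ?c k)) / T"
    using assms by (subst sum_distrib_left[symmetric]) (simp add: field_simps)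
  ultimately show ?thesis
    by (simp add: dirichlet_primitive_def[abs_def])
qed

lemma sum_cos_symmetric:
  fixes \<phi> :: real
  assumes "N \<ge> 1"
  shows "(\<Sum>k = - int N + 1..int N - 1. cos (of_int k * \<phi>)) = 1 + 2 * (\<Sum>k=1..<N. cos (real k * \<phi>))"
  using assms
proof (induction N rule: nat_induct_at_least)
  case base
  show ?case by simp
next
  case (Suc N)
  \<comment> \<open>The induction step adds the frequencies N and -N, whose cosines agree.\<close>
  have "{- int (Suc N) + 1..int (Suc N) - 1} = insert (- int N) (insert (int N) {- int N + 1..int N - 1})"
    by auto
  then show ?case
    using Suc by simp
qed

section \<open>Laws with finitely many values\<close>

text \<open>Almost surely \<open>h\<close> agrees with a finite combination of indicators. The
  Banach-valued form serves both complex exponentials and real indicators.\<close>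

lemma (in real_distribution) expectation_finite_support:
  fixes h :: "real \<Rightarrow> 'b :: {banach, second_countable_topology}"
  assumes S: "finite S" "AE z in M. z \<in> S" and h: "h \<in> borel_measurable borel"
  shows "(\<integral>z. h z \<partial>M) = (\<Sum>z\<in>S. prob {z} *\<^sub>R h z)"
proof -
  have [measurable]: "h \<in> borel_measurable M" using h by simp
  have "(\<integral>z. h z \<partial>M) = (\<integral>z. (\<Sum>s\<in>S. indicator {s} z *\<^sub>R h s) \<partial>M)"
  proof (rule integral_cong_AE)
    show "AE z in M. h z = (\<Sum>s\<in>S. indicator {s} z *\<^sub>R h s)"
      using S(2)
    proof eventually_elim
      case (elim z)
      have "(\<Sum>s\<in>S. indicator {s} z *\<^sub>R h s) = (\<Sum>s\<in>{z}. indicator {s} z *\<^sub>R h s)"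
        using elim S(1) by (intro sum.mono_neutral_right) auto
      then show ?case by simp
    qed
  qed measurable
  also have "\<dots> = (\<Sum>s\<in>S. prob {s} *\<^sub>R h s)"
    by (subst Bochner_Integration.integral_sum) (simp_all add: emeasure_eq_measure)
  finally show ?thesis .
qed

lemma (in real_distribution) cdf_finite_support:
  assumes "finite S" "AE z in M. z \<in> S"
  shows "cdf M x = (\<Sum>z\<in>S. prob {z} * of_bool (z \<le> x))"
proof -
  have "cdf M x = (\<integral>z. indicator {..x} z \<partial>M)"
    by (simp add: cdf_def)
  also have "\<dots> = (\<Sum>z\<in>S. prob {z} *\<^sub>R indicator {..x} z)"
    by (rule expectation_finite_support[OF assms]) simp
  finally show ?thesis
    by (simp add: indicator_def of_bool_def)
qed

section \<open>Empirical laws and the characteristic function of their linear combination\<close>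

text \<open>A law on the line is determined by its distribution function. Choosing an index
  uniformly, rather than a value, counts repeated data points with multiplicity.\<close>

lemma empirical_law_unique:
  assumes "real_distribution \<nu>" and "n \<ge> 1" and cdf: "\<And>t. cdf \<nu> t = emp_cdf n X t"
  shows "\<nu> = distr (measure_pmf (pmf_of_set {1..n})) borel X"
proof (rule cdf_unique[OF assms(1)])
  let ?U = "measure_pmf (pmf_of_set {1..n})"
  show "real_distribution (distr ?U borel X)"
    by (rule prob_space.real_distribution_distr[OF measure_pmf.prob_space_axioms]) simp
  show "cdf \<nu> = cdf (distr ?U borel X)"
  proof
    fix t
    have "cdf (distr ?U borel X) t = measure ?U {l. X l \<le> t}"
      by (simp add: cdf_def measure_distr vimage_def)
    also have "\<dots> = real (card ({1..n} \<inter> {l. X l \<le> t})) / real n"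
      using assms(2) by (subst measure_pmf_of_set) auto
    also have "\<dots> = emp_cdf n X t"
      by (simp add: emp_cdf_def of_bool_def sum.If_cases)
    finally show "cdf \<nu> t = cdf (distr ?U borel X) t"
      by (simp add: cdf)
  qed
qed

lemma char_empirical_law:
  assumes "n \<ge> 1"
  shows "char (distr (measure_pmf (pmf_of_set {1..n})) borel X) t
    = 1 / of_nat n * (\<Sum>l=1..n. iexp (t * X l))"
proof -
  have "char (distr (measure_pmf (pmf_of_set {1..n})) borel X) t =
      (\<integral>l. iexp (t * X l) \<partial>measure_pmf (pmf_of_set {1..n}))"
    unfolding char_def by (subst integral_distr) auto
  also have "\<dots> = (\<Sum>l=1..n. pmf (pmf_of_set {1..n}) l *\<^sub>R iexp (t * X l))"
    using assms by (intro integral_measure_pmf) auto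
  also have "\<dots> = 1 / of_nat n * (\<Sum>l=1..n. iexp (t * X l))"
    using assms by (simp add: sum_distrib_left scaleR_conv_of_real)
  finally show ?thesis .
qed

text \<open>Independence factorises the characteristic function of the sum, scaling by
  \<open>a j\<close> rescales the argument, and each factor is an empirical average of
  exponentials.\<close>

lemma (in prob_space) G_fun_eq_char:
  assumes n: "n \<ge> 1" and indep: "indep_vars (\<lambda>_. borel) Y {1..m}"
    and cdf: "\<And>j t. j \<in> {1..m} \<Longrightarrow> cdf (distr M borel (Y j)) t = emp_cdf n X t"
  shows "G_fun n m X a \<nu> = char (distr M borel (\<lambda>\<omega>. \<Sum>j=1..m. a j * Y j \<omega>)) (- 2 * pi * \<nu>)"
proof -
  have char_Y: "char (distr M borel (\<lambda>\<omega>. a j * Y j \<omega>)) t = 1 / of_nat n * (\<Sum>l=1..n. iexp (t * a j * X l))"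
    if j: "j \<in> {1..m}" for j t
  proof -
    have Yj [measurable]: "random_variable borel (Y j)"
      using indep j by (auto simp: indep_vars_def2)
    have "char (distr M borel (\<lambda>\<omega>. a j * Y j \<omega>)) t = char (distr M borel (Y j)) (t * a j)"
      unfolding char_def by (subst (1 2) integral_distr) (auto simp: mult.assoc)
    also have "distr M borel (Y j) = distr (measure_pmf (pmf_of_set {1..n})) borel X"
      using cdf[OF j] n by (intro empirical_law_unique) simp_all
    finally show ?thesis
      using char_empirical_law[OF n] by simp
  qed
  have "indep_vars (\<lambda>_. borel) (\<lambda>j \<omega>. a j * Y j \<omega>) {1..m}"
    by (rule indep_vars_compose2[OF indep]) simp
  then have "char (distr M borel (\<lambda>\<omega>. \<Sum>j=1..m. a j * Y j \<omega>)) (- 2 * pi * \<nu>) =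
      (\<Prod>j=1..m. char (distr M borel (\<lambda>\<omega>. a j * Y j \<omega>)) (- 2 * pi * \<nu>))"
    by (rule char_distr_sum)
  also have "\<dots> = G_fun n m X a \<nu>"
    unfolding G_fun_def
    by (intro prod.cong refl) (simp add: char_Y algebra_simps)
  finally show ?thesis by simp
qed

text \<open>Almost surely every \<open>Y j\<close> is a data point, so the combination takes values
  in the image of a finite set of tuples.\<close>

lemma (in prob_space) linear_combination_empirical_finite_support:
  fixes Y :: "nat \<Rightarrow> 'a \<Rightarrow> real"
  assumes n: "n \<ge> 1" and rv: "\<And>j. j \<in> {1..m} \<Longrightarrow> random_variable borel (Y j)"
    and cdf: "\<And>j t. j \<in> {1..m} \<Longrightarrow> cdf (distr M borel (Y j)) t = emp_cdf n X t"
  obtains S where "finite S" "AE z in distr M borel (\<lambda>\<omega>. \<Sum>j=1..m. a j * Y j \<omega>). z \<in> S"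
proof
  let ?S = "(\<lambda>y. \<Sum>j=1..m. a j * y j) ` (\<Pi>\<^sub>E j\<in>{1..m}. X ` {1..n})"
  show S: "finite ?S" by (intro finite_imageI finite_PiE) auto
  have Y: "AE \<omega> in M. Y j \<omega> \<in> X ` {1..n}" if j: "j \<in> {1..m}" for j
  proof -
    have "AE y in distr (measure_pmf (pmf_of_set {1..n})) borel X. y \<in> X ` {1..n}"
      using n by (subst AE_distr_iff)
        (auto simp: AE_measure_pmf_iff intro!: borel_closed finite_imp_closed)
    also have "distr (measure_pmf (pmf_of_set {1..n})) borel X = distr M borel (Y j)"
      using cdf[OF j] n rv[OF j] by (intro empirical_law_unique[symmetric]) simp_all
    finally show ?thesis
      using rv[OF j] by (subst (asm) AE_distr_iff)
        (auto intro!: borel_closed finite_imp_closed)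
  qed
  have "AE \<omega> in M. \<forall>j\<in>{1..m}. Y j \<omega> \<in> X ` {1..n}"
    using Y by (intro AE_finite_allI) simp_all
  then have "AE \<omega> in M. (\<Sum>j=1..m. a j * Y j \<omega>) \<in> ?S"
  proof eventually_elim
    case (elim \<omega>)
    \<comment> \<open>Members of the product set are \<open>undefined\<close> off the index set;
      restricting the tuple does not change the sum.\<close>
    then have "restrict (\<lambda>j. Y j \<omega>) {1..m} \<in> (\<Pi>\<^sub>E j\<in>{1..m}. X ` {1..n})" by auto
    then show ?case by (rule rev_image_eqI) simp
  qed
  moreover have "?S \<in> sets borel"
    using S by (intro borel_closed finite_imp_closed)
  ultimately show "AE z in distr M borel (\<lambda>\<omega>. \<Sum>j=1..m. a j * Y j \<omega>). z \<in> ?S"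
    using rv by (subst AE_distr_iff) auto
qed

text \<open>Discarding the finitely many null points of \<open>S\<close> loses only a null set. The
  support can then be taken to be the set whose extremes define \<open>z_min\<close> and
  \<open>z_max\<close>.\<close>

lemma (in real_distribution) AE_atoms:
  assumes "finite S" "AE z in M. z \<in> S"
  shows "finite {z. prob {z} > 0}" "AE z in M. z \<in> {z. prob {z} > 0}"
proof -
  have AE_not: "AE y in M. y \<noteq> z" if "prob {z} = 0" for z
    using that by (intro AE_I[where N = "{z}"]) (auto simp: emeasure_eq_measure)
  have "z \<in> S" if "prob {z} > 0" for z
  proof (rule ccontr)
    assume "z \<notin> S"
    with assms(2) have "AE y in M. y \<notin> {z}" by (auto elim: eventually_mono)
    then have "prob {z} = 0" by (subst prob_eq_0) auto
    with that show False by simp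
  qed
  then show "finite {z. prob {z} > 0}"
    using assms(1) by (auto intro: finite_subset)
  have "AE y in M. \<forall>z\<in>{z\<in>S. prob {z} = 0}. y \<noteq> z"
    using assms(1) AE_not by (intro AE_finite_allI) auto
  with assms(2) show "AE z in M. z \<in> {z. prob {z} > 0}"
    by eventually_elim (auto simp: zero_less_measure_iff)
qed

section \<open>The approximation as a mixture of shifted kernels\<close>

text \<open>Expanding each coefficient over the atoms merges it with its exponential into phases in
  \<open>\<xi> - z\<close>. Real parts leave cosines, and the factor \<open>N\<close> cancels the
  normalisation of \<open>f_tilde\<close>.\<close>

lemma (in real_distribution) scaled_f_tilde_eq:
  assumes S: "finite S" "AE z in M. z \<in> S" and N: "N \<ge> 1"
    and G: "\<And>\<nu>. G_fun n m X a \<nu> = char M (- 2 * pi * \<nu>)"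
  shows "real N / T * f_tilde n m X a T N \<xi> =
    (\<Sum>z\<in>S. prob {z} * ((1 + 2 * (\<Sum>k=1..<N. cos (real k * (2 * pi * (\<xi> - z) / T)))) / T))"
proof -
  have "g_coeff n m X a T k = (\<Sum>z\<in>S. prob {z} *\<^sub>R iexp (- 2 * pi * (of_int k / T) * z))" for k
    unfolding g_coeff_def G char_def
    by (subst expectation_finite_support[OF S]) simp_all
  moreover have "exp (2 * of_real pi * \<i> * of_real (\<xi> * of_int k / T)) = iexp (2 * pi * \<xi> * of_int k / T)" for k
    by (simp add: mult_ac)
  moreover have "iexp (- 2 * pi * (of_int k / T) * z) * iexp (2 * pi * \<xi> * of_int k / T) =
      iexp (of_int k * (2 * pi * (\<xi> - z) / T))" for k z
    by (simp add: algebra_simps diff_divide_distrib flip: exp_add)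
  ultimately have "g_coeff n m X a T k * exp (2 * of_real pi * \<i> * of_real (\<xi> * of_int k / T)) =
      (\<Sum>z\<in>S. prob {z} *\<^sub>R iexp (of_int k * (2 * pi * (\<xi> - z) / T)))" for k
    by (simp only: sum_distrib_right mult_scaleR_left)
  then have "Re (g_coeff n m X a T k * exp (2 * of_real pi * \<i> * of_real (\<xi> * of_int k / T))) =
      (\<Sum>z\<in>S. prob {z} * cos (of_int k * (2 * pi * (\<xi> - z) / T)))" for k
    by (simp only: Re_sum scaleR_complex.simps Re_exp Re_i_times Im_i_times Re_complex_of_real
        Im_complex_of_real minus_zero exp_zero mult_1)
  then have "f_tilde n m X a T N \<xi> =
      (\<Sum>k = - int N + 1..int N - 1. \<Sum>z\<in>S. prob {z} * cos (of_int k * (2 * pi * (\<xi> - z) / T))) / real N"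
    unfolding f_tilde_def f_tilde_complex_def
    by (simp add: Re_divide_of_nat)
  also have "\<dots> = (\<Sum>z\<in>S. prob {z} *
      (\<Sum>k = - int N + 1..int N - 1. cos (of_int k * (2 * pi * (\<xi> - z) / T)))) / real N"
    by (subst sum.swap) (simp add: sum_distrib_left)
  also have "\<dots> = (\<Sum>z\<in>S. prob {z} *
      (1 + 2 * (\<Sum>k=1..<N. cos (real k * (2 * pi * (\<xi> - z) / T))))) / real N"
    by (simp only: sum_cos_symmetric[OF N])
  finally show ?thesis
    using N by (simp flip: sum_divide_distrib)
qed

text \<open>The fundamental theorem of calculus, applied to each shifted kernel. The indicator of
  the interval stops the integration at \<open>\<beta>\<close>, hence the minimum.\<close>

lemma (in real_distribution) F_tilde_eq:
  assumes S: "finite S" "AE z in M. z \<in> S" and N: "N \<ge> 1" and T: "T \<noteq> 0"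
    and G: "\<And>\<nu>. G_fun n m X a \<nu> = char M (- 2 * pi * \<nu>)"
    and x: "\<alpha> \<le> \<beta>" "\<alpha> \<le> x"
  shows "F_tilde n m X a T {\<alpha>..\<beta>} N x =
    (\<Sum>z\<in>S. prob {z} * (dirichlet_primitive T N (min x \<beta> - z) - dirichlet_primitive T N (\<alpha> - z)))"
proof -
  let ?d = "\<lambda>\<xi>. \<Sum>z\<in>S. prob {z} * ((1 + 2 * (\<Sum>k=1..<N. cos (real k * (2 * pi * (\<xi> - z) / T)))) / T)"
  let ?D = "\<lambda>\<xi>. \<Sum>z\<in>S. prob {z} * dirichlet_primitive T N (\<xi> - z)"
  have "F_tilde n m X a T {\<alpha>..\<beta>} N x = (\<integral>\<xi>. ?d \<xi> * indicator {\<alpha>..min x \<beta>} \<xi> \<partial>lborel)"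
    unfolding F_tilde_def set_lebesgue_integral_def scaled_f_tilde_eq[OF S N G]
    by (intro Bochner_Integration.integral_cong) (auto simp: indicator_def)
  also have "\<dots> = ?D (min x \<beta>) - ?D \<alpha>"
  proof (rule integral_FTC_Icc_real)
    show "\<alpha> \<le> min x \<beta>" using x by simp
    show "(?D has_field_derivative ?d \<xi>) (at \<xi>)" for \<xi>
    proof (intro DERIV_sum DERIV_cmult)
      fix z
      have "((\<lambda>\<xi>. \<xi> - z) has_field_derivative 1) (at \<xi>)"
        by (auto intro!: derivative_eq_intros)
      from DERIV_chain2[OF has_field_derivative_dirichlet_primitive[OF T, of N] this]
      show "((\<lambda>\<xi>. dirichlet_primitive T N (\<xi> - z)) has_field_derivative
          (1 + 2 * (\<Sum>k=1..<N. cos (real k * (2 * pi * (\<xi> - z) / T)))) / T) (at \<xi>)"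
        by simp
    qed
    show "isCont ?d \<xi>" for \<xi>
      using T by (intro continuous_intros) auto
  qed
  finally show ?thesis
    by (simp add: sum_subtractf right_diff_distrib)
qed

section \<open>Convergence at a fixed point\<close>

lemma F_tilde_eq_0:
  assumes "x < \<alpha>"
  shows "F_tilde n m X a T {\<alpha>..\<beta>} N x = 0"
proof -
  have "indicator {..x} \<xi> *\<^sub>R (real N / T * f_tilde n m X a T N \<xi> * indicator {\<alpha>..\<beta>} \<xi>) = 0" for \<xi>
    using assms by (auto simp: indicator_def)
  then show ?thesis
    by (simp only: F_tilde_def set_lebesgue_integral_def integral_zero)
qed

text \<open>In the limit an atom contributes half the difference of the signs at the two endpoints,
  which is 1 if the atom lies left of \<open>x\<close> and 0 otherwise; the weighted sum is the
  distribution function.\<close>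

lemma (in real_distribution) F_tilde_error_bigo:
  assumes S: "finite S" "AE z in M. z \<in> S" "x \<notin> S" "S \<subseteq> {\<alpha><..<\<beta>}"
    and T: "\<And>z. z \<in> S \<Longrightarrow> z - \<alpha> < T \<and> \<beta> - z < T" "T > 0" and "\<alpha> \<le> \<beta>"
    and G: "\<And>\<nu>. G_fun n m X a \<nu> = char M (- 2 * pi * \<nu>)"
  shows "(\<lambda>N. F_tilde n m X a T {\<alpha>..\<beta>} N x - cdf M x) \<in> O(\<lambda>N. 1 / real N)"
proof (cases "x < \<alpha>")
  case True
  with S have "cdf M x = 0"
    by (subst cdf_finite_support[OF S(1,2)]) (auto intro!: sum.neutral)
  with True show ?thesis
    by (simp add: F_tilde_eq_0)
next
  case False
  let ?w = "dirichlet_primitive T"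
  let ?y = "min x \<beta>"
  have "(\<lambda>N. (?w N (?y - z) - sgn (?y - z) / 2) - (?w N (\<alpha> - z) - sgn (\<alpha> - z) / 2))
      \<in> O(\<lambda>N. 1 / real N)" if z: "z \<in> S" for z
  proof -
    \<comment> \<open>The upper endpoint is \<open>x\<close>, which is no atom, or
      \<open>\<beta>\<close>, which exceeds every atom; so neither primitive is evaluated at its
      jump.\<close>
    have "z \<noteq> x" "\<alpha> < z" "z < \<beta>" using z S by auto
    then show ?thesis
      using T(1)[OF z] T(2) False
      by (intro sum_in_bigo dirichlet_primitive_bigo) (auto simp: min_def)
  qed
  then have "(\<lambda>N. \<Sum>z\<in>S. prob {z} *
      ((?w N (?y - z) - sgn (?y - z) / 2) - (?w N (\<alpha> - z) - sgn (\<alpha> - z) / 2))) \<in> O(\<lambda>N. 1 / real N)"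
    by (intro big_sum_in_bigo) simp
  moreover have "\<forall>\<^sub>F N in sequentially. (\<Sum>z\<in>S. prob {z} *
      ((?w N (?y - z) - sgn (?y - z) / 2) - (?w N (\<alpha> - z) - sgn (\<alpha> - z) / 2)))
      = F_tilde n m X a T {\<alpha>..\<beta>} N x - cdf M x"
  proof (rule eventually_sequentiallyI[of 1])
    fix N :: nat assume N: "1 \<le> N"
    have "sgn (?y - z) / 2 - sgn (\<alpha> - z) / 2 = of_bool (z \<le> x)" if "z \<in> S" for z
    proof -
      have "z \<noteq> x" "\<alpha> < z" "z < \<beta>" using that S by auto
      then show ?thesis by (auto simp: sgn_if min_def)
    qed
    then have "cdf M x = (\<Sum>z\<in>S. prob {z} * (sgn (?y - z) / 2 - sgn (\<alpha> - z) / 2))"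
      by (simp add: cdf_finite_support[OF S(1,2)])
    moreover have "F_tilde n m X a T {\<alpha>..\<beta>} N x =
        (\<Sum>z\<in>S. prob {z} * (?w N (?y - z) - ?w N (\<alpha> - z)))"
      using F_tilde_eq[OF S(1,2) N _ G \<open>\<alpha> \<le> \<beta>\<close>, of T x] T(2) False by simp
    ultimately show "(\<Sum>z\<in>S. prob {z} *
      ((?w N (?y - z) - sgn (?y - z) / 2) - (?w N (\<alpha> - z) - sgn (\<alpha> - z) / 2)))
      = F_tilde n m X a T {\<alpha>..\<beta>} N x - cdf M x"
      by (simp only: sum_subtractf[symmetric] right_diff_distrib[symmetric])
        (intro sum.cong, simp_all add: algebra_simps)
  qed
  ultimately show ?thesis
    by (rule landau_o.big.in_cong[THEN iffD1, rotated])
qed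

section \<open>Application to \<open>Z\<close> and the interval \<open>I\<close>\<close>

theorem mainTheorem3:
  fixes n m :: nat and X a :: "nat \<Rightarrow> real"
    and M :: "'w measure" and Y :: "nat \<Rightarrow> 'w \<Rightarrow> real" and Z :: "'w \<Rightarrow> real"
    and F\<^sub>Z :: "real \<Rightarrow> real" and T \<kappa> x :: real and I :: "real set"
  assumes "n \<ge> 1" and "m \<ge> 1"
    and "prob_space M"
    and "prob_space.indep_vars M (\<lambda>_. borel) Y {1..m}"
    and "\<And>j t. j \<in> {1..m} \<Longrightarrow> cdf (distr M borel (Y j)) t = emp_cdf n X t"
    and "Z = (\<lambda>\<omega>. \<Sum>j=1..m. a j * Y j \<omega>)"
    and "F\<^sub>Z = cdf (distr M borel Z)"
    and "z_min M Z < 0" and "0 < z_max M Z"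
    and "T > T_range M Z"
    and "\<kappa> = T / T_range M Z"
    and "I = {\<kappa> * z_min M Z..\<kappa> * z_max M Z}"
    and "isCont F\<^sub>Z x"
  shows "(\<lambda>N. \<bar>F_tilde n m X a T I N x - F\<^sub>Z x\<bar>) \<in> O(\<lambda>N. real N powr (- 1 / 2))"
proof -
  interpret prob_space M by fact
  have rv: "random_variable borel (Y j)" if "j \<in> {1..m}" for j
    using assms(4) that by (auto simp: indep_vars_def2)
  then have rv_Z: "random_variable borel Z"
    unfolding assms(6) by (intro borel_measurable_sum borel_measurable_times) auto
  interpret law: real_distribution "distr M borel Z"
    using rv_Z by simp
  obtain S\<^sub>0 where S\<^sub>0: "finite S\<^sub>0" "AE z in distr M borel Z. z \<in> S\<^sub>0"
    unfolding assms(6)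
    using linear_combination_empirical_finite_support[OF assms(1) rv assms(5)] .
  define S where "S = pos_prob_values M Z"
  have S_eq: "S = {z. law.prob {z} > 0}"
    unfolding S_def pos_prob_values_def using rv_Z
    by (subst measure_distr) (auto simp: vimage_def Int_def conj_commute)
  have S: "finite S" "AE z in distr M borel Z. z \<in> S"
    unfolding S_eq by (rule law.AE_atoms[OF S\<^sub>0])+
  \<comment> \<open>A distribution function is continuous exactly at the points of zero
    mass.\<close>
  have "x \<notin> S"
    using assms(13) unfolding assms(7) law.isCont_cdf by (simp add: S_eq)
  have range: "z_min M Z \<le> z" "z \<le> z_max M Z" if "z \<in> S" for z
    using that S(1) unfolding z_min_def z_max_def S_def by auto
  have T_range: "T_range M Z > 0" using assms(8,9) by (simp add: T_range_def)
  have \<kappa>: "\<kappa> > 1" using T_range assms(10) by (simp add: assms(11))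
  \<comment> \<open>The choice of \<open>\<kappa>\<close> makes \<open>I\<close> exactly one period
    long.\<close>
  have len: "\<kappa> * z_max M Z - \<kappa> * z_min M Z = T"
    using T_range unfolding right_diff_distrib[symmetric] by (simp add: assms(11) T_range_def)
  \<comment> \<open>As \<open>z_min\<close> is negative and \<open>z_max\<close> positive, scaling
    by \<open>\<kappa>\<close> moves both endpoints strictly outwards.\<close>
  have lo: "\<kappa> * z_min M Z < z_min M Z" and hi: "z_max M Z < \<kappa> * z_max M Z"
    using \<kappa> assms(8,9) by (auto simp: mult_less_cancel_right1)
  have "(\<lambda>N. F_tilde n m X a T I N x - F\<^sub>Z x) \<in> O(\<lambda>N. 1 / real N)"
    unfolding assms(7) assms(12)
  proof (rule law.F_tilde_error_bigo[OF S \<open>x \<notin> S\<close>])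
    show "S \<subseteq> {\<kappa> * z_min M Z<..<\<kappa> * z_max M Z}"
      using range lo hi by force
    \<comment> \<open>The distance from an atom to one endpoint is the period minus its positive
      distance to the other.\<close>
    show "z - \<kappa> * z_min M Z < T \<and> \<kappa> * z_max M Z - z < T" if "z \<in> S" for z
      using range[OF that] lo hi len by linarith
    show "T > 0" using T_range assms(10) by simp
    show "\<kappa> * z_min M Z \<le> \<kappa> * z_max M Z"
      using len \<open>T > 0\<close> by linarith
    show "G_fun n m X a \<nu> = char (distr M borel Z) (- 2 * pi * \<nu>)" for \<nu>
      unfolding assms(6) by (rule G_fun_eq_char[OF assms(1,4,5)])
  qed
  moreover have "(\<lambda>N. 1 / real N) \<in> O(\<lambda>N. real N powr (- 1 / 2))"
    by real_asymp
  ultimately show ?thesis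
    by (simp add: landau_o.big_trans)
qed

end
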